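(* For all integers $n\ge 3$ and all integers $k$ such that $2\le k\le n-1$, we have, as an inequality in the extended real half line $[0,\infty]$, $$\liminf_{p\rightarrow\infty}\frac{A(p,n,k)^2}{A(p,n,k-1)\,A(p,n,k+1)}\ \ge\ 1,$$ where $p$ ranges over positive integers.
   Context: For integers $p\ge 1$ and $1\le k\le n$, $A(p,n,k)$ denotes the number of ordered $p$-tuples $(\sigma_1,\ldots,\sigma_p)$ of permutations in the symmetric group $\mathfrak{S}_n$ (permutations of $[n]:=\{1,\ldots,n\}$) which commute pairwise and are such that the subgroup $\langle\sigma_1,\ldots,\sigma_p\rangle$ of $\mathfrak{S}_n$ they generate has exactly $k$ orbits in its natural action on $[n]$. One has $A(p,n,k)\ge 1$ for all $p\ge1$ and $1\le k\le n$ (take all $\sigma_i$ equal to the cycle $(1,2,\ldots,n-k+1)$), so the ratio is well defined. *)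

theory Defs
  imports
    "HOL-Algebra.Sym_Groups"
    "HOL-Algebra.Group_Action"
    "HOL-Library.Extended_Nonnegative_Real"
begin

definition perm_subgroup :: "nat \<Rightarrow> (nat \<Rightarrow> nat) set \<Rightarrow> (nat \<Rightarrow> nat) monoid" where
  "perm_subgroup n S = (sym_group n)\<lparr>carrier := generate (sym_group n) S\<rparr>"

text \<open>Elements of \<^term>\<open>sym_group n\<close> are functions on all of \<^typ>\<open>nat\<close> that fix every
  number outside \<open>{1..n}\<close>, while \<^locale>\<open>group_action\<close> wants functions that are extensional on
  the set acted upon; hence the restriction.\<close>

definition natural_action :: "nat \<Rightarrow> (nat \<Rightarrow> nat) \<Rightarrow> nat \<Rightarrow> nat" where
  "natural_action n \<sigma> = restrict \<sigma> {1..n}"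

definition commuting_tuples :: "nat \<Rightarrow> nat \<Rightarrow> nat \<Rightarrow> (nat \<Rightarrow> nat) list set" where
  "commuting_tuples p n k =
     {\<sigma>s. length \<sigma>s = p \<and>
          set \<sigma>s \<subseteq> carrier (sym_group n) \<and>
          (\<forall>i<p. \<forall>j<p. \<sigma>s ! i \<otimes>\<^bsub>sym_group n\<^esub> \<sigma>s ! j = \<sigma>s ! j \<otimes>\<^bsub>sym_group n\<^esub> \<sigma>s ! i) \<and>
          card (orbits (perm_subgroup n (set \<sigma>s)) {1..n} (natural_action n)) = k}"

definition A :: "nat \<Rightarrow> nat \<Rightarrow> nat \<Rightarrow> nat" where
  "A p n k = card (commuting_tuples p n k)"

lemma group_action_natural_action:
  assumes "S \<subseteq> carrier (sym_group n)"
  shows "group_action (perm_subgroup n S) {1..n} (natural_action n)"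
proof -
  interpret G: group "sym_group n"
    by (rule sym_group_is_group)
  have H: "subgroup (generate (sym_group n) S) (sym_group n)"
    using assms by (rule G.generate_is_subgroup)
  have Bij: "natural_action n \<sigma> \<in> Bij {1..n}" if "\<sigma> permutes {1..n}" for \<sigma>
    using permutes_imp_bij[OF that]
    by (simp add: natural_action_def Bij_def bij_betw_restrict_eq)
  have comp: "natural_action n (\<sigma> \<circ> \<tau>) =
      compose {1..n} (natural_action n \<sigma>) (natural_action n \<tau>)"
    if "\<tau> permutes {1..n}" for \<sigma> \<tau>
    using permutes_in_image[OF that]
    by (auto simp: natural_action_def compose_def restrict_def fun_eq_iff)
  have perm: "\<sigma> permutes {1..n}" if "\<sigma> \<in> generate (sym_group n) S" for \<sigma>
    using subgroup.subset[OF H] that by (auto simp: sym_group_carrier)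
  show ?thesis
    unfolding perm_subgroup_def
    by (intro group_action.intro group_hom.intro group_hom_axioms.intro
        G.subgroup_imp_group[OF H] group_BijGroup homI)
       (auto simp: BijGroup_def sym_group_mult Bij comp perm simp del: One_nat_def)
qed

lemma finite_commuting_tuples: "finite (commuting_tuples p n k)"
proof (rule finite_subset)
  show "commuting_tuples p n k \<subseteq> {\<sigma>s. set \<sigma>s \<subseteq> {\<sigma>. \<sigma> permutes {1..n}} \<and> length \<sigma>s = p}"
    by (auto simp: commuting_tuples_def sym_group_carrier)
  show "finite {\<sigma>s. set \<sigma>s \<subseteq> {\<sigma>. \<sigma> permutes {1..n}} \<and> length \<sigma>s = p}"
    by (intro finite_lists_length_eq finite_permutations) simp
qed

end

theory Submission
  imports Defs "HOL-Computational_Algebra.Formal_Power_Series"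
begin

text \<open>
A tuple of commuting permutations splits into transitive tuples on its orbits. If
\<open>F\<^sub>p(x) = (\<Sum>m\<ge>1. T\<^sub>p(m) x\<^sup>m / m!)\<close>, where \<open>T\<^sub>p(m)\<close> is the number of transitive commuting \<open>p\<close>-tuples on
\<open>m\<close> points, the exponential formula (\<open>A_eq_coeff\<close>) therefore expresses \<open>A p n k\<close> as \<open>n! / k!\<close> times
the coefficient of \<open>x\<^sup>n\<close> in \<open>F\<^sub>p\<^sup>k\<close>, a sum over the compositions of \<open>n\<close> into \<open>k\<close> parts.

For fixed \<open>m\<close> the number \<open>T\<^sub>p(m)\<close> is of the order \<open>m\<^sup>p\<close>: from below because tuples of rotations of
a cycle commute (\<open>transitive_count_ge\<close>), from above because the commutant of a transitive tuple has at
most \<open>m\<close> elements (\<open>transitive_count_le\<close>). So as \<open>p\<close> grows, the compositions of \<open>n\<close> into \<open>k\<close> parts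
with the largest product dominate, and these are the balanced ones, with all parts equal to
\<open>q = n div k\<close> or \<open>q + 1\<close>.

To compare the three numbers \<open>k - 1\<close>, \<open>k\<close>, \<open>k + 1\<close> of orbits, divide \<open>T\<^sub>p(m)\<close> by \<open>(c r\<^sup>m)\<^sup>p\<close>, where
\<open>c r\<^sup>m\<close> is the exponential that equals \<open>m\<close> at \<open>q\<close> and \<open>q + 1\<close>. This divides \<open>A p n j\<close> by
\<open>(c\<^sup>j r\<^sup>n)\<^sup>p\<close>, which is geometric in \<open>j\<close>, so the ratio in question does not change. Since \<open>ln\<close> is
strictly concave, \<open>c r\<^sup>m > m\<close> for all other \<open>m\<close> (\<open>supporting_exponential\<close>). The normalised weights are
therefore bounded, they tend to \<open>0\<close> except at \<open>q\<close> and \<open>q + 1\<close>, and there they are bounded away from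
\<open>0\<close>. Up to \<open>o(1)\<close>, only compositions with parts \<open>q\<close> and \<open>q + 1\<close> contribute. Their contribution to
the normalised \<open>A p n j\<close> is \<open>n! \<alpha>\<^sup>a \<beta>\<^sup>b / (a! b!)\<close>, where \<open>a\<close> and \<open>b\<close> are the numbers of parts \<open>q\<close>
and \<open>q + 1\<close> and depend affinely on \<open>j\<close>; it is \<open>0\<close> if no such composition exists. This is log-concave
in \<open>j\<close> by the log-convexity of the factorial (\<open>two_term_log_concave\<close>), and bounded away from \<open>0\<close> for
\<open>j = k\<close>. Passing to the limit (\<open>liminf_ratio_ge_one\<close>) gives the claim, both when the balanced products
for \<open>k - 1\<close>, \<open>k\<close>, \<open>k + 1\<close> satisfy a strict inequality and when they are in geometric progression.
\<close>

unbundle fps_syntax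

section \<open>Orbits as reachable sets\<close>

text \<open>The orbit of \<open>x\<close> under the group generated by \<open>F\<close>, described by forward steps alone. For
permutations of a finite set this loses nothing (\<open>reach_sym\<close>), and unlike the generated group it
does not change when the maps are modified outside an invariant set containing \<open>x\<close>.\<close>

inductive_set reach :: "('a \<Rightarrow> 'a) set \<Rightarrow> 'a \<Rightarrow> 'a set"
  for F x where
    refl: "x \<in> reach F x"
  | step: "y \<in> reach F x \<Longrightarrow> \<sigma> \<in> F \<Longrightarrow> \<sigma> y \<in> reach F x"

lemma reach_trans: "z \<in> reach F y \<Longrightarrow> y \<in> reach F x \<Longrightarrow> z \<in> reach F x"
  by (induction rule: reach.induct) (auto intro: reach.step)

lemma reach_subset:
  assumes "\<forall>\<sigma>\<in>F. \<sigma> ` S \<subseteq> S" "x \<in> S"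
  shows "reach F x \<subseteq> S"
proof
  fix y assume "y \<in> reach F x"
  then show "y \<in> S" using assms by induction auto
qed

text \<open>A step \<open>z \<mapsto> \<sigma> z\<close> can be undone: \<open>\<sigma>\<close> maps the finite set reachable from \<open>\<sigma> z\<close> injectively into
itself, hence onto itself, and \<open>\<sigma> z\<close> lies in that set, so its only preimage \<open>z\<close> does too.\<close>

lemma reach_sym:
  assumes "finite S" "\<forall>\<sigma>\<in>F. \<sigma> permutes S" "x \<in> S" "y \<in> reach F x"
  shows "x \<in> reach F y"
  using assms(4)
proof induction
  case refl
  show ?case by (rule reach.refl)
next
  case (step z \<sigma>)
  have sub: "\<forall>\<sigma>\<in>F. \<sigma> ` S \<subseteq> S"
    using assms(2) by (auto simp: permutes_in_image)
  have "z \<in> S" using step.hyps(1) reach_subset[OF sub assms(3)] by blast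
  let ?R = "reach F (\<sigma> z)"
  have inj: "inj \<sigma>" using assms(2) step.hyps(2) by (auto intro: permutes_inj)
  have "\<sigma> z \<in> S" using \<open>z \<in> S\<close> sub step.hyps(2) by blast
  then have "finite ?R"
    using reach_subset[OF sub] assms(1) finite_subset by blast
  moreover have "\<sigma> ` ?R \<subseteq> ?R" using step.hyps(2) by (auto intro: reach.step)
  ultimately have "\<sigma> ` ?R = ?R"
    using inj by (intro endo_inj_surj) (auto intro: inj_on_subset)
  then have "\<sigma> z \<in> \<sigma> ` ?R" using reach.refl[of "\<sigma> z" F] by simp
  then have "z \<in> ?R" using inj by (auto dest: injD)
  then show ?case using step.IH reach_trans by metis
qed

lemma reach_eq:
  assumes "finite S" "\<forall>\<sigma>\<in>F. \<sigma> permutes S" "x \<in> S" "y \<in> reach F x"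
  shows "reach F y = reach F x"
  using reach_sym[OF assms] assms(4) by (auto intro: reach_trans)

text \<open>Only the values on an invariant set containing the starting point matter. Used in both directions,
this says that restricting all maps to such a set keeps the orbits inside it.\<close>

lemma reach_mono_on:
  assumes "x \<in> B" "\<forall>\<sigma>\<in>F. \<sigma> ` B \<subseteq> B" "\<forall>\<sigma>\<in>F. \<exists>\<tau>\<in>G. \<forall>y\<in>B. \<tau> y = \<sigma> y"
  shows "reach F x \<subseteq> reach G x"
proof
  fix y assume "y \<in> reach F x"
  then have "y \<in> reach G x \<and> y \<in> B"
  proof induction
    case refl
    show ?case using assms(1) by (simp add: reach.refl)
  next
    case (step y \<sigma>)
    obtain \<tau> where "\<tau> \<in> G" "\<tau> y = \<sigma> y" using assms(3) step by blast
    then show ?case using step assms(2) reach.step[of y G x \<tau>] by auto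
  qed
  then show "y \<in> reach G x" ..
qed

lemma reach_restrict:
  assumes "x \<in> B" "\<forall>\<sigma>\<in>F. \<sigma> ` B \<subseteq> B"
  shows "reach ((\<lambda>\<sigma>. restrict_id \<sigma> B) ` F) x = reach F x"
  using assms by (intro equalityI reach_mono_on[where B = B]) auto

lemma reach_invariant:
  assumes "finite S" "\<forall>\<sigma>\<in>F. \<sigma> permutes S" "B \<in> reach F ` S"
  shows "B \<subseteq> S" "B \<noteq> {}" "\<forall>\<sigma>\<in>F. \<sigma> ` B = B" "\<And>x. x \<in> B \<Longrightarrow> reach F x = B"
proof -
  obtain a where a: "a \<in> S" "B = reach F a" using assms(3) by blast
  have sub: "\<forall>\<sigma>\<in>F. \<sigma> ` S \<subseteq> S"
    using assms(2) by (auto simp: permutes_in_image)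
  show BS: "B \<subseteq> S" using reach_subset[OF sub a(1)] a(2) by simp
  show "B \<noteq> {}" using a(2) reach.refl[of a F] by auto
  show "\<forall>\<sigma>\<in>F. \<sigma> ` B = B"
  proof
    fix \<sigma> assume \<sigma>: "\<sigma> \<in> F"
    have "\<sigma> ` B \<subseteq> B" using \<sigma> a(2) by (auto intro: reach.step)
    moreover have "inj_on \<sigma> B" using assms(2) \<sigma> permutes_inj_on by blast
    moreover have "finite B" using BS assms(1) finite_subset by blast
    ultimately show "\<sigma> ` B = B" by (simp add: endo_inj_surj)
  qed
  show "reach F x = B" if "x \<in> B" for x
    using reach_eq[OF assms(1,2) a(1)] that a(2) by blast
qed

section \<open>Commuting tuples on arbitrary finite sets\<close>

text \<open>The tuples counted by \<^const>\<open>A\<close>, but on an arbitrary ground set: the recurrence below cuts a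
tuple into its parts on one orbit and on the complement of that orbit.\<close>

definition comm_tuples :: "nat \<Rightarrow> 'a set \<Rightarrow> nat \<Rightarrow> ('a \<Rightarrow> 'a) list set" where
  "comm_tuples p S k = {\<sigma>s. length \<sigma>s = p \<and> (\<forall>\<sigma>\<in>set \<sigma>s. \<sigma> permutes S) \<and>
     (\<forall>\<sigma>\<in>set \<sigma>s. \<forall>\<tau>\<in>set \<sigma>s. \<sigma> \<circ> \<tau> = \<tau> \<circ> \<sigma>) \<and> card (reach (set \<sigma>s) ` S) = k}"

lemma finite_comm_tuples:
  assumes "finite S"
  shows "finite (comm_tuples p S k)"
proof (rule finite_subset)
  show "comm_tuples p S k \<subseteq> {\<sigma>s. set \<sigma>s \<subseteq> {\<sigma>. \<sigma> permutes S} \<and> length \<sigma>s = p}"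
    by (auto simp: comm_tuples_def)
  show "finite {\<sigma>s. set \<sigma>s \<subseteq> {\<sigma>. \<sigma> permutes S} \<and> length \<sigma>s = p}"
    using assms by (intro finite_lists_length_eq finite_permutations)
qed

text \<open>Products of generators act by composing steps, and inverses of generators act by undoing steps.\<close>

lemma orbit_generate_eq_reach:
  assumes F: "F \<subseteq> carrier (sym_group n)" and x: "x \<in> {1..n}"
  shows "orbit (perm_subgroup n F) (natural_action n) x = reach F x"
proof -
  interpret G: group "sym_group n" by (rule sym_group_is_group)
  have perm: "\<forall>\<sigma>\<in>F. \<sigma> permutes {1..n}"
    using F by (auto simp: sym_group_carrier)
  have orb: "orbit (perm_subgroup n F) (natural_action n) x = {g x | g. g \<in> generate (sym_group n) F}"
    using x by (auto simp: orbit_def perm_subgroup_def natural_action_def)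
  have inv: "inv\<^bsub>sym_group n\<^esub> \<sigma> = inv' \<sigma>" if "\<sigma> \<in> F" for \<sigma>
  proof (rule G.inv_equality)
    have p: "\<sigma> permutes {1..n}" using perm that by blast
    show "inv' \<sigma> \<otimes>\<^bsub>sym_group n\<^esub> \<sigma> = \<one>\<^bsub>sym_group n\<^esub>"
      using permutes_inv_o(2)[OF p] by (simp add: sym_group_mult sym_group_one)
    show "\<sigma> \<in> carrier (sym_group n)" "inv' \<sigma> \<in> carrier (sym_group n)"
      using p permutes_inv[OF p] by (auto simp: sym_group_carrier)
  qed
  have gen: "g y \<in> reach F y \<and> g y \<in> {1..n}" if "g \<in> generate (sym_group n) F" "y \<in> {1..n}" for g y
    using that
  proof (induction arbitrary: y rule: generate.induct)
    case one
    then show ?case by (simp add: sym_group_one reach.refl)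
  next
    case (incl h)
    then show ?case using perm permutes_in_image[of h "{1..n}" y]
      by (auto intro: reach.step reach.refl)
  next
    case (inv h)
    have h: "h permutes {1..n}" using perm inv.hyps by blast
    have y: "inv' h y \<in> {1..n}" using permutes_in_image[OF permutes_inv[OF h]] inv.prems by blast
    have "h (inv' h y) \<in> reach F (inv' h y)"
      by (rule reach.step[OF reach.refl inv.hyps])
    then have "y \<in> reach F (inv' h y)" using permutes_inverses(1)[OF h] by simp
    then have "inv' h y \<in> reach F y" using reach_sym[OF _ perm y] by simp
    then show ?case using y \<open>\<And>\<sigma>. \<sigma> \<in> F \<Longrightarrow> inv\<^bsub>sym_group n\<^esub> \<sigma> = inv' \<sigma>\<close> inv.hyps by simp
  next
    case (eng h1 h2)
    have "h2 y \<in> reach F y \<and> h2 y \<in> {1..n}" using eng by blast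
    moreover have "h1 (h2 y) \<in> reach F (h2 y) \<and> h1 (h2 y) \<in> {1..n}" using eng calculation by blast
    ultimately show ?case using reach_trans by (auto simp: sym_group_mult)
  qed
  have "\<exists>g \<in> generate (sym_group n) F. y = g x" if "y \<in> reach F x" for y
    using that
  proof induction
    case refl
    show ?case using generate.one[of "sym_group n" F] by (intro bexI[of _ id]) (simp_all add: sym_group_one)
  next
    case (step y \<sigma>)
    then obtain g where "g \<in> generate (sym_group n) F" "y = g x" by blast
    then show ?case
      using step.hyps(2)
      by (intro bexI[OF _ generate.eng[OF generate.incl]]) (auto simp: sym_group_mult)
  qed
  then show ?thesis unfolding orb using gen x by blast
qed

lemma A_eq_card_comm_tuples: "A p n k = card (comm_tuples p {1..n} k)"
proof -
  have "orbits (perm_subgroup n (set \<sigma>s)) {1..n} (natural_action n) = reach (set \<sigma>s) ` {1..n}"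
    if "set \<sigma>s \<subseteq> carrier (sym_group n)" for \<sigma>s
    using orbit_generate_eq_reach[OF that] by (fastforce simp: orbits_def)
  moreover have "(\<forall>i<p. \<forall>j<p. \<sigma>s ! i \<circ> \<sigma>s ! j = \<sigma>s ! j \<circ> \<sigma>s ! i) \<longleftrightarrow>
      (\<forall>\<sigma>\<in>set \<sigma>s. \<forall>\<tau>\<in>set \<sigma>s. \<sigma> \<circ> \<tau> = \<tau> \<circ> \<sigma>)" if "length \<sigma>s = p" for \<sigma>s :: "(nat \<Rightarrow> nat) list"
    using that by (auto simp: all_set_conv_all_nth)
  moreover have "set \<sigma>s \<subseteq> carrier (sym_group n) \<longleftrightarrow> (\<forall>\<sigma>\<in>set \<sigma>s. \<sigma> permutes {1..n})" for \<sigma>s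
    by (auto simp: sym_group_carrier)
  ultimately have "commuting_tuples p n k = comm_tuples p {1..n} k"
    unfolding commuting_tuples_def comm_tuples_def sym_group_mult
    by (intro Collect_cong conj_cong) simp_all
  then show ?thesis by (simp add: A_def)
qed

lemma reach_map_permutation:
  assumes f: "bij_betw f S T" and F: "\<forall>\<sigma>\<in>F. \<sigma> permutes S" and x: "x \<in> S"
  shows "reach (map_permutation S f ` F) (f x) = f ` reach F x"
proof (intro equalityI subsetI)
  have inj: "inj_on f S" using f by (rule bij_betw_imp_inj_on)
  have sub: "reach F x \<subseteq> S" using F x by (intro reach_subset) (auto simp: permutes_in_image)
  show "y \<in> f ` reach F x" if "y \<in> reach (map_permutation S f ` F) (f x)" for y
    using that
  proof induction
    case refl
    show ?case by (intro imageI reach.refl)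
  next
    case (step y \<sigma>)
    then obtain z \<tau> where "z \<in> reach F x" "y = f z" "\<tau> \<in> F" "\<sigma> = map_permutation S f \<tau>" by blast
    then show ?case using sub map_permutation_apply[OF inj, of z \<tau>] by (auto intro: reach.step)
  qed
  show "y \<in> reach (map_permutation S f ` F) (f x)" if "y \<in> f ` reach F x" for y
  proof -
    have "f z \<in> reach (map_permutation S f ` F) (f x)" if "z \<in> reach F x" for z
      using that
    proof induction
      case refl
      show ?case by (rule reach.refl)
    next
      case (step z \<sigma>)
      have "map_permutation S f \<sigma> (f z) \<in> reach (map_permutation S f ` F) (f x)"
        by (rule reach.step[OF step.IH imageI[OF step.hyps(2)]])
      then show ?case using map_permutation_apply[OF inj, of z \<sigma>] step sub by auto
    qed
    then show ?thesis using that by blast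
  qed
qed

lemma map_permutation_comm_tuples:
  assumes f: "bij_betw f S T" and \<sigma>s: "\<sigma>s \<in> comm_tuples p S k"
  shows "map (map_permutation S f) \<sigma>s \<in> comm_tuples p T k"
proof -
  have inj: "inj_on f S" using f by (rule bij_betw_imp_inj_on)
  have perm: "\<forall>\<sigma>\<in>set \<sigma>s. \<sigma> permutes S" using \<sigma>s by (simp add: comm_tuples_def)
  have "reach (map_permutation S f ` set \<sigma>s) ` T = (`) f ` reach (set \<sigma>s) ` S"
    using bij_betw_imp_surj_on[OF f] reach_map_permutation[OF f perm] by (fastforce simp: image_iff)
  moreover have "inj_on ((`) f) (reach (set \<sigma>s) ` S)"
  proof (rule inj_on_subset[OF inj_on_image_Pow[OF inj]])
    show "reach (set \<sigma>s) ` S \<subseteq> Pow S"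
    proof -
      have "\<forall>\<sigma>\<in>set \<sigma>s. \<sigma> ` S \<subseteq> S" using perm permutes_image by blast
      then have "reach (set \<sigma>s) x \<subseteq> S" if "x \<in> S" for x using reach_subset that by metis
      then show ?thesis by blast
    qed
  qed
  ultimately have "card (reach (map_permutation S f ` set \<sigma>s) ` T) = k"
    using \<sigma>s by (simp add: card_image comm_tuples_def)
  moreover have "map_permutation S f \<sigma> \<circ> map_permutation S f \<tau> = map_permutation S f \<tau> \<circ> map_permutation S f \<sigma>"
    if "\<sigma> \<in> set \<sigma>s" "\<tau> \<in> set \<sigma>s" for \<sigma> \<tau>
    using map_permutation_compose'[OF inj, of \<tau> \<sigma>] map_permutation_compose'[OF inj, of \<sigma> \<tau>] perm \<sigma>s that
    by (simp add: comm_tuples_def)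
  ultimately show ?thesis
    using \<sigma>s map_permutation_permutes[OF f] by (auto simp: comm_tuples_def)
qed

text \<open>Conjugation by a bijection \<open>S \<rightarrow> T\<close> carries orbits to orbits. So the counts depend on the size of
the ground set only, which turns the sum over subsets in \<open>marked_class_recurrence\<close> into a
binomial convolution.\<close>

lemma card_comm_tuples_cong:
  assumes "finite S" "finite T" "card S = card T"
  shows "card (comm_tuples p S k) = card (comm_tuples p T k)"
proof -
  obtain f where f: "bij_betw f S T" using assms finite_same_card_bij by blast
  let ?g = "inv_into S f"
  have g: "bij_betw ?g T S" using f by (rule bij_betw_inv_into)
  have "bij_betw (map (map_permutation S f)) (comm_tuples p S k) (comm_tuples p T k)"
  proof (rule bij_betw_byWitness[where f' = "map (map_permutation T ?g)"])
    show "\<forall>\<sigma>s\<in>comm_tuples p S k. map (map_permutation T ?g) (map (map_permutation S f) \<sigma>s) = \<sigma>s"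
      using map_permutation_compose_inv[OF f, of _ ?g] bij_betw_inv_into_left[OF f]
      by (auto simp: comm_tuples_def intro!: map_idI)
    show "\<forall>\<sigma>s\<in>comm_tuples p T k. map (map_permutation S f) (map (map_permutation T ?g) \<sigma>s) = \<sigma>s"
      using map_permutation_compose_inv[OF g, of _ f] bij_betw_inv_into_right[OF f]
      by (auto simp: comm_tuples_def intro!: map_idI)
  qed (use map_permutation_comm_tuples[OF f] map_permutation_comm_tuples[OF g] in auto)
  then show ?thesis by (rule bij_betw_same_card)
qed

text \<open>An orbit meeting an invariant set \<open>B\<close> lies inside \<open>B\<close>, so the orbits inside and outside \<open>B\<close> can be
counted separately.\<close>

lemma card_reach_split:
  assumes S: "finite S" and B: "B \<subseteq> S" and F: "\<forall>\<sigma>\<in>F. \<sigma> permutes S \<and> \<sigma> ` B = B"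
  shows "card (reach F ` S) = card (reach ((\<lambda>\<sigma>. restrict_id \<sigma> B) ` F) ` B)
           + card (reach ((\<lambda>\<sigma>. restrict_id \<sigma> (S - B)) ` F) ` (S - B))"
proof -
  have co: "\<sigma> ` (S - B) = S - B" if "\<sigma> \<in> F" for \<sigma>
    using F that by (metis image_set_diff permutes_image permutes_inj)
  have "reach ((\<lambda>\<sigma>. restrict_id \<sigma> B) ` F) ` B = reach F ` B"
    using F reach_restrict[of _ B F] by (intro image_cong) auto
  moreover have "reach ((\<lambda>\<sigma>. restrict_id \<sigma> (S - B)) ` F) ` (S - B) = reach F ` (S - B)"
    using co reach_restrict[of _ "S - B" F] by (intro image_cong) auto
  moreover have "reach F ` S = reach F ` B \<union> reach F ` (S - B)" using B by blast
  moreover have "reach F ` B \<inter> reach F ` (S - B) = {}"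
  proof -
    have "reach F x \<subseteq> B" if "x \<in> B" for x using F that by (intro reach_subset) auto
    moreover have "x \<in> reach F x" for x by (rule reach.refl)
    ultimately show ?thesis by blast
  qed
  ultimately show ?thesis
    using S B by (simp add: card_Un_disjoint finite_subset)
qed

lemma card_reach_eq_1_iff:
  assumes "finite B" "\<forall>\<sigma>\<in>F. \<sigma> permutes B"
  shows "card (reach F ` B) = 1 \<longleftrightarrow> B \<noteq> {} \<and> (\<forall>x\<in>B. reach F x = B)"
proof
  assume "card (reach F ` B) = 1"
  then obtain X where X: "reach F ` B = {X}" using card_1_singletonE by blast
  have eq: "reach F x = X" if "x \<in> B" for x using X that by auto
  then have "B \<subseteq> X" using reach.refl[of _ F] by auto
  moreover have "X \<subseteq> B" using reach_invariant(1)[OF assms, of X] X by simp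
  ultimately show "B \<noteq> {} \<and> (\<forall>x\<in>B. reach F x = B)" using X eq by auto
next
  assume "B \<noteq> {} \<and> (\<forall>x\<in>B. reach F x = B)"
  then have "reach F ` B = {B}" by auto
  then show "card (reach F ` B) = 1" by simp
qed

lemma restrict_id_bij:
  assumes "\<sigma> permutes S" "\<sigma> ` B = B"
  shows "restrict_id \<sigma> B permutes B"
  using assms by (intro permutes_restrict_id) (auto simp: bij_betw_def permutes_inj_on)

text \<open>All conditions on a tuple that leaves \<open>B\<close> invariant can be tested on \<open>B\<close> and on \<open>S - B\<close>
separately; that \<open>B\<close> is itself an orbit means that the part on \<open>B\<close> is transitive.\<close>

lemma comm_tuples_split_iff:
  assumes S: "finite S" and B: "B \<subseteq> S" and F: "\<forall>\<sigma>\<in>set \<sigma>s. \<sigma> permutes S \<and> \<sigma> ` B = B"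
  shows "\<sigma>s \<in> comm_tuples p S (Suc k) \<and> B \<in> reach (set \<sigma>s) ` S \<longleftrightarrow>
    map (\<lambda>\<sigma>. restrict_id \<sigma> B) \<sigma>s \<in> comm_tuples p B 1 \<and>
    map (\<lambda>\<sigma>. restrict_id \<sigma> (S - B)) \<sigma>s \<in> comm_tuples p (S - B) k"
    (is "?L \<longleftrightarrow> ?R1 \<and> ?R2")
proof -
  let ?F = "set \<sigma>s"
  let ?F1 = "(\<lambda>\<sigma>. restrict_id \<sigma> B) ` ?F" and ?F2 = "(\<lambda>\<sigma>. restrict_id \<sigma> (S - B)) ` ?F"
  have finB: "finite B" using S B finite_subset by blast
  have co: "\<sigma> ` (S - B) = S - B" if "\<sigma> \<in> ?F" for \<sigma>
    using F that by (metis image_set_diff permutes_image permutes_inj)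
  have P1: "\<forall>\<sigma>\<in>?F1. \<sigma> permutes B" and P2: "\<forall>\<sigma>\<in>?F2. \<sigma> permutes (S - B)"
    using F co restrict_id_bij[of _ S] by auto
  have comm: "\<sigma> \<circ> \<tau> = \<tau> \<circ> \<sigma> \<longleftrightarrow>
      restrict_id \<sigma> B \<circ> restrict_id \<tau> B = restrict_id \<tau> B \<circ> restrict_id \<sigma> B \<and>
      restrict_id \<sigma> (S - B) \<circ> restrict_id \<tau> (S - B) = restrict_id \<tau> (S - B) \<circ> restrict_id \<sigma> (S - B)"
    if "\<sigma> \<in> ?F" "\<tau> \<in> ?F" for \<sigma> \<tau>
  proof -
    have a: "\<sigma> x \<in> B" "\<tau> x \<in> B" if "x \<in> B" for x using F \<open>\<sigma> \<in> ?F\<close> \<open>\<tau> \<in> ?F\<close> that by blast+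
    have b: "\<sigma> x \<in> S - B" "\<tau> x \<in> S - B" if "x \<in> S - B" for x
      using co \<open>\<sigma> \<in> ?F\<close> \<open>\<tau> \<in> ?F\<close> that by blast+
    have c: "\<sigma> x = x" "\<tau> x = x" if "x \<notin> S" for x
      using F \<open>\<sigma> \<in> ?F\<close> \<open>\<tau> \<in> ?F\<close> that by (meson permutes_not_in)+
    have "restrict_id \<sigma> B \<circ> restrict_id \<tau> B = restrict_id \<tau> B \<circ> restrict_id \<sigma> B \<longleftrightarrow>
        (\<forall>x\<in>B. \<sigma> (\<tau> x) = \<tau> (\<sigma> x))"
      using a by (auto simp: fun_eq_iff restrict_id_def)
    moreover have "restrict_id \<sigma> (S - B) \<circ> restrict_id \<tau> (S - B) = restrict_id \<tau> (S - B) \<circ> restrict_id \<sigma> (S - B) \<longleftrightarrow>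
        (\<forall>x\<in>S - B. \<sigma> (\<tau> x) = \<tau> (\<sigma> x))"
      using b by (auto simp: fun_eq_iff restrict_id_def)
    moreover have "\<sigma> \<circ> \<tau> = \<tau> \<circ> \<sigma> \<longleftrightarrow> (\<forall>x\<in>B. \<sigma> (\<tau> x) = \<tau> (\<sigma> x)) \<and> (\<forall>x\<in>S - B. \<sigma> (\<tau> x) = \<tau> (\<sigma> x))"
    proof -
      have "\<sigma> (\<tau> x) = \<tau> (\<sigma> x)" if "\<forall>x\<in>B. \<sigma> (\<tau> x) = \<tau> (\<sigma> x)" "\<forall>x\<in>S - B. \<sigma> (\<tau> x) = \<tau> (\<sigma> x)" for x
        using that c[of x] by (cases "x \<in> S") auto
      then show ?thesis unfolding fun_eq_iff o_apply by blast
    qed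
    ultimately show ?thesis by blast
  qed
  have orb: "B \<in> reach ?F ` S \<longleftrightarrow> card (reach ?F1 ` B) = 1"
  proof -
    have "reach ?F1 x = reach ?F x" if "x \<in> B" for x
      using F that by (intro reach_restrict) auto
    then have "card (reach ?F1 ` B) = 1 \<longleftrightarrow> B \<noteq> {} \<and> (\<forall>x\<in>B. reach ?F x = B)"
      using card_reach_eq_1_iff[OF finB P1] by simp
    also have "\<dots> \<longleftrightarrow> B \<in> reach ?F ` S"
    proof
      assume "B \<noteq> {} \<and> (\<forall>x\<in>B. reach ?F x = B)"
      then obtain x where "x \<in> B" "reach ?F x = B" by blast
      then show "B \<in> reach ?F ` S" using B by blast
    next
      assume "B \<in> reach ?F ` S"
      moreover have "\<forall>\<sigma>\<in>?F. \<sigma> permutes S" using F by blast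
      ultimately show "B \<noteq> {} \<and> (\<forall>x\<in>B. reach ?F x = B)"
        using reach_invariant(2,4)[OF S] by metis
    qed
    finally show ?thesis by simp
  qed
  note card = card_reach_split[OF S B F]
  have "?L \<longleftrightarrow> length \<sigma>s = p \<and> (\<forall>\<sigma>\<in>?F. \<forall>\<tau>\<in>?F. \<sigma> \<circ> \<tau> = \<tau> \<circ> \<sigma>) \<and>
      card (reach ?F1 ` B) = 1 \<and> card (reach ?F2 ` (S - B)) = k"
    unfolding comm_tuples_def mem_Collect_eq orb card using F by auto
  also have "\<dots> \<longleftrightarrow> ?R1 \<and> ?R2"
    unfolding comm_tuples_def mem_Collect_eq length_map set_map using P1 P2 comm by blast
  finally show ?thesis .
qed

section \<open>The exponential formula\<close>

text \<open>Both sides count the pairs of a tuple and one of its \<open>Suc k\<close> orbits \<open>B\<close>. Such a pair is the same as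
a transitive tuple on \<open>B\<close> together with a tuple on \<open>S - B\<close> that has \<open>k\<close> orbits; in the other
direction the two are glued by composing entrywise.\<close>

lemma marked_class_recurrence:
  assumes S: "finite S"
  shows "Suc k * card (comm_tuples p S (Suc k)) =
    (\<Sum>B\<in>Pow S. card (comm_tuples p B 1) * card (comm_tuples p (S - B) k))"
proof -
  let ?X = "SIGMA \<sigma>s:comm_tuples p S (Suc k). reach (set \<sigma>s) ` S"
  let ?Y = "SIGMA B:Pow S. comm_tuples p B 1 \<times> comm_tuples p (S - B) k"
  let ?f = "\<lambda>(\<sigma>s, B). (B, map (\<lambda>\<sigma>. restrict_id \<sigma> B) \<sigma>s, map (\<lambda>\<sigma>. restrict_id \<sigma> (S - B)) \<sigma>s)"
  let ?g = "\<lambda>(B, \<alpha>, \<beta>). (map2 (\<circ>) \<alpha> \<beta>, B)"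
  have 1: "?f (\<sigma>s, B) \<in> ?Y \<and> ?g (?f (\<sigma>s, B)) = (\<sigma>s, B)" if "(\<sigma>s, B) \<in> ?X" for \<sigma>s B
  proof -
    have \<sigma>s: "\<sigma>s \<in> comm_tuples p S (Suc k)" "B \<in> reach (set \<sigma>s) ` S" using that by auto
    then have perm: "\<forall>\<sigma>\<in>set \<sigma>s. \<sigma> permutes S" by (simp add: comm_tuples_def)
    note inv = reach_invariant[OF S perm \<sigma>s(2)]
    have F: "\<forall>\<sigma>\<in>set \<sigma>s. \<sigma> permutes S \<and> \<sigma> ` B = B" using perm inv(3) by blast
    have "restrict_id \<sigma> B \<circ> restrict_id \<sigma> (S - B) = \<sigma>" if "\<sigma> \<in> set \<sigma>s" for \<sigma>
    proof
      fix x
      have "\<sigma> ` (S - B) = S - B" using F that by (metis image_set_diff permutes_image permutes_inj)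
      then show "(restrict_id \<sigma> B \<circ> restrict_id \<sigma> (S - B)) x = \<sigma> x"
        using inv(1) F that permutes_not_in[of \<sigma> S x] by (auto simp: restrict_id_def)
    qed
    then show ?thesis
      using comm_tuples_split_iff[OF S inv(1) F, of p k] \<sigma>s inv(1)
      by (auto simp: map2_map_map intro: map_idI)
  qed
  have 2: "?g (B, \<alpha>, \<beta>) \<in> ?X \<and> ?f (?g (B, \<alpha>, \<beta>)) = (B, \<alpha>, \<beta>)" if "(B, \<alpha>, \<beta>) \<in> ?Y" for B \<alpha> \<beta>
  proof -
    let ?\<sigma>s = "map2 (\<circ>) \<alpha> \<beta>"
    have B: "B \<subseteq> S" and \<alpha>: "\<alpha> \<in> comm_tuples p B 1" and \<beta>: "\<beta> \<in> comm_tuples p (S - B) k"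
      using that by auto
    have len: "length \<alpha> = p" "length \<beta> = p" using \<alpha> \<beta> by (auto simp: comm_tuples_def)
    have glue: "(a \<circ> b) permutes S \<and> (a \<circ> b) ` B = B \<and> restrict_id (a \<circ> b) B = a \<and>
        restrict_id (a \<circ> b) (S - B) = b" if "a permutes B" "b permutes (S - B)" for a b
    proof (intro conjI)
      have b: "b x = x" if "x \<in> B" for x using \<open>b permutes (S - B)\<close> that permutes_not_in by fastforce
      show "(a \<circ> b) permutes S"
        using that B by (intro permutes_compose) (auto intro: permutes_subset)
      show "(a \<circ> b) ` B = B" using b permutes_image[OF that(1)] by (simp add: image_comp[symmetric])
      show "restrict_id (a \<circ> b) B = a"
        using b permutes_not_in[OF that(1)] by (auto simp: restrict_id_def fun_eq_iff)
      have "a (b x) = b x" if "x \<in> S - B" for x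
        using that permutes_in_image[OF \<open>b permutes (S - B)\<close>, of x] permutes_not_in[OF \<open>a permutes B\<close>] by blast
      then show "restrict_id (a \<circ> b) (S - B) = b"
        using permutes_not_in[OF that(2)] by (auto simp: restrict_id_def fun_eq_iff)
    qed
    have ab: "a permutes B" "b permutes (S - B)" if "(a, b) \<in> set (zip \<alpha> \<beta>)" for a b
      using set_zip_leftD[OF that] set_zip_rightD[OF that] \<alpha> \<beta> by (auto simp: comm_tuples_def)
    have F: "\<forall>\<sigma>\<in>set ?\<sigma>s. \<sigma> permutes S \<and> \<sigma> ` B = B"
      using glue ab by fastforce
    have r1: "map (\<lambda>\<sigma>. restrict_id \<sigma> B) ?\<sigma>s = \<alpha>"
    proof -
      have "map (\<lambda>\<sigma>. restrict_id \<sigma> B) ?\<sigma>s = map fst (zip \<alpha> \<beta>)"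
        using glue ab by (auto simp del: map_fst_zip)
      then show ?thesis using len by simp
    qed
    have r2: "map (\<lambda>\<sigma>. restrict_id \<sigma> (S - B)) ?\<sigma>s = \<beta>"
    proof -
      have "map (\<lambda>\<sigma>. restrict_id \<sigma> (S - B)) ?\<sigma>s = map snd (zip \<alpha> \<beta>)"
        using glue ab by (auto simp del: map_snd_zip)
      then show ?thesis using len by simp
    qed
    show ?thesis
      using comm_tuples_split_iff[OF S B F, of p k] \<alpha> \<beta> unfolding r1 r2 split_conv by (simp add: r1 r2)
  qed
  have "bij_betw ?f ?X ?Y"
    by (rule bij_betw_byWitness[where f' = ?g]) (use 1 2 in blast)+
  then have "card ?X = card ?Y" by (rule bij_betw_same_card)
  moreover have "card ?X = Suc k * card (comm_tuples p S (Suc k))"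
  proof -
    have "card ?X = (\<Sum>\<sigma>s\<in>comm_tuples p S (Suc k). card (reach (set \<sigma>s) ` S))"
      using S by (intro card_SigmaI) (auto simp: finite_comm_tuples)
    also have "\<dots> = (\<Sum>\<sigma>s\<in>comm_tuples p S (Suc k). Suc k)"
      by (intro sum.cong) (auto simp: comm_tuples_def)
    finally show ?thesis by simp
  qed
  moreover have "card ?Y = (\<Sum>B\<in>Pow S. card (comm_tuples p B 1) * card (comm_tuples p (S - B) k))"
    using S by (subst card_SigmaI) (auto simp: finite_comm_tuples card_cartesian_product finite_subset)
  ultimately show ?thesis by simp
qed

definition transitive_count :: "nat \<Rightarrow> nat \<Rightarrow> nat" where
  "transitive_count p m = card (comm_tuples p {..<m} 1)"

text \<open>The exponential generating function of transitive commuting \<open>p\<close>-tuples. Its constant term is \<open>0\<close>,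
since on the empty set there are no orbits at all.\<close>

definition transitive_egf :: "nat \<Rightarrow> real fps" where
  "transitive_egf p = Abs_fps (\<lambda>m. real (transitive_count p m) / fact m)"

lemma sum_Pow_by_card:
  fixes h :: "nat \<Rightarrow> real"
  assumes "finite S"
  shows "(\<Sum>B\<in>Pow S. h (card B)) = (\<Sum>m=0..card S. real (card S choose m) * h m)"
proof -
  have "(\<Sum>B\<in>Pow S. h (card B)) = (\<Sum>m=0..card S. \<Sum>B\<in>{B \<in> Pow S. card B = m}. h (card B))"
    using assms by (intro sum.group[symmetric]) (auto intro: card_mono)
  also have "\<dots> = (\<Sum>m=0..card S. real (card S choose m) * h m)"
    using n_subsets[OF assms] by (intro sum.cong) auto
  finally show ?thesis .
qed

lemma card_comm_tuples_zero:
  assumes "finite S"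
  shows "card (comm_tuples p S 0) = (if S = {} then 1 else 0)"
proof (cases "S = {}")
  case True
  have "comm_tuples p S 0 = {replicate p id}"
    unfolding comm_tuples_def using True by (auto intro: replicate_eqI)
  then show ?thesis using True by simp
next
  case False
  then have "comm_tuples p S 0 = {}" using assms by (auto simp: comm_tuples_def)
  then show ?thesis using False by simp
qed

text \<open>With the factorials of exponential generating functions, \<open>marked_class_recurrence\<close> says that
passing from \<open>k\<close> to \<open>Suc k\<close> orbits multiplies the generating function by
\<open>transitive_egf p / Suc k\<close>.\<close>

lemma card_comm_tuples_eq_coeff:
  assumes "finite S"
  shows "real (card (comm_tuples p S k)) = fact (card S) / fact k * (transitive_egf p ^ k) $ card S"
  using assms
proof (induction k arbitrary: S)
  case 0
  then show ?case by (simp add: card_comm_tuples_zero)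
next
  case (Suc k)
  let ?n = "card S" and ?F = "transitive_egf p"
  let ?h = "\<lambda>m. real (transitive_count p m) * (fact (?n - m) / fact k * (?F ^ k) $ (?n - m))"
  have "real (Suc k) * real (card (comm_tuples p S (Suc k))) =
      (\<Sum>B\<in>Pow S. real (card (comm_tuples p B 1)) * real (card (comm_tuples p (S - B) k)))"
    unfolding of_nat_mult[symmetric] of_nat_sum[symmetric] marked_class_recurrence[OF Suc.prems] ..
  also have "\<dots> = (\<Sum>B\<in>Pow S. ?h (card B))"
  proof (rule sum.cong[OF HOL.refl])
    fix B assume "B \<in> Pow S"
    then have B: "B \<subseteq> S" "finite B" using Suc.prems finite_subset by auto
    have "card (comm_tuples p B 1) = transitive_count p (card B)"
      unfolding transitive_count_def using B by (intro card_comm_tuples_cong) auto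
    moreover have "real (card (comm_tuples p (S - B) k)) = fact (card (S - B)) / fact k * (?F ^ k) $ card (S - B)"
      using Suc.prems by (intro Suc.IH) auto
    moreover have "card (S - B) = ?n - card B" using B by (intro card_Diff_subset)
    ultimately show "real (card (comm_tuples p B 1)) * real (card (comm_tuples p (S - B) k)) = ?h (card B)"
      by simp
  qed
  also have "\<dots> = (\<Sum>m=0..?n. real (?n choose m) * ?h m)"
    by (rule sum_Pow_by_card[OF Suc.prems])
  also have "\<dots> = (\<Sum>m=0..?n. fact ?n / fact k * (?F $ m * (?F ^ k) $ (?n - m)))"
    by (intro sum.cong) (auto simp: binomial_fact transitive_egf_def field_simps)
  also have "\<dots> = fact ?n / fact k * (?F ^ Suc k) $ ?n"
    by (simp add: sum_distrib_left fps_mult_nth)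
  finally have "real (card (comm_tuples p S (Suc k))) = fact ?n / fact k * (?F ^ Suc k) $ ?n / real (Suc k)"
    by (simp add: eq_divide_eq mult.commute del: power_Suc of_nat_Suc)
  then show ?case by (simp add: fact_Suc mult_ac del: power_Suc of_nat_Suc)
qed

corollary A_eq_coeff: "real (A p n k) = fact n / fact k * (transitive_egf p ^ k) $ n"
  using card_comm_tuples_eq_coeff[of "{1..n}" p k] by (simp add: A_eq_card_comm_tuples)

section \<open>The number of transitive commuting tuples up to bounded factors\<close>

text \<open>A permutation commuting with a transitive tuple is determined by its value at one point, since
commutation propagates this value along the orbit.\<close>

lemma card_commutant_le:
  assumes S: "finite S" and \<sigma>s: "\<sigma>s \<in> comm_tuples p S 1"
  shows "card {\<tau>. \<tau> permutes S \<and> (\<forall>\<sigma>\<in>set \<sigma>s. \<tau> \<circ> \<sigma> = \<sigma> \<circ> \<tau>)} \<le> card S" (is "card ?C \<le> _")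
proof -
  have "\<forall>\<sigma>\<in>set \<sigma>s. \<sigma> permutes S" "card (reach (set \<sigma>s) ` S) = 1"
    using \<sigma>s by (auto simp: comm_tuples_def)
  then have "S \<noteq> {} \<and> (\<forall>x\<in>S. reach (set \<sigma>s) x = S)" using card_reach_eq_1_iff[OF S] by simp
  then obtain a where a: "a \<in> S" "reach (set \<sigma>s) a = S" by blast
  have "inj_on (\<lambda>\<tau>. \<tau> a) ?C"
  proof (intro inj_onI ext)
    fix \<tau> \<tau>' x assume \<tau>: "\<tau> \<in> ?C" "\<tau>' \<in> ?C" "\<tau> a = \<tau>' a"
    have "\<tau> y = \<tau>' y" if "y \<in> reach (set \<sigma>s) a" for y
      using that
    proof induction
      case refl
      show ?case by (rule \<tau>(3))
    next
      case (step y \<sigma>)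
      have "\<tau> (\<sigma> y) = \<sigma> (\<tau> y)" "\<tau>' (\<sigma> y) = \<sigma> (\<tau>' y)"
        using \<tau>(1,2) step.hyps(2) by (auto simp: fun_eq_iff)
      then show ?case using step.IH by simp
    qed
    then have "\<tau> x = \<tau>' x" if "x \<in> S" using that a(2) by simp
    moreover have "\<tau> x = x" "\<tau>' x = x" if "x \<notin> S"
      using \<tau>(1,2) that by (auto intro: permutes_not_in)
    ultimately show "\<tau> x = \<tau>' x" by metis
  qed
  moreover have "(\<lambda>\<tau>. \<tau> a) ` ?C \<subseteq> S" using a(1) by (auto simp: permutes_in_image)
  ultimately show ?thesis using S by (rule card_inj_on_le)
qed

text \<open>The entries of a commuting tuple lie in its commutant. So every transitive tuple has its entries in
one of boundedly many sets of at most \<open>m\<close> permutations, where the bound does not depend on \<open>p\<close>.\<close>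

lemma transitive_count_le: "transitive_count p m \<le> card (Pow {\<sigma>. \<sigma> permutes {..<m}}) * m ^ p"
proof -
  let ?P = "{\<sigma>. \<sigma> permutes {..<m}}"
  let ?K = "{C \<in> Pow ?P. card C \<le> m}"
  let ?L = "\<lambda>C. {\<sigma>s. set \<sigma>s \<subseteq> C \<and> length \<sigma>s = p}"
  have finP: "finite ?P" by (simp add: finite_permutations)
  then have finK: "finite ?K" by simp
  have finC: "finite C" if "C \<in> ?K" for C using that finP finite_subset by blast
  have "comm_tuples p {..<m} 1 \<subseteq> (\<Union>C\<in>?K. ?L C)"
  proof
    fix \<sigma>s assume \<sigma>s: "\<sigma>s \<in> comm_tuples p {..<m} 1"
    let ?C = "{\<tau>. \<tau> permutes {..<m} \<and> (\<forall>\<sigma>\<in>set \<sigma>s. \<tau> \<circ> \<sigma> = \<sigma> \<circ> \<tau>)}"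
    have "?C \<in> ?K" using card_commutant_le[OF _ \<sigma>s] by auto
    moreover have "\<sigma>s \<in> ?L ?C" using \<sigma>s by (auto simp: comm_tuples_def)
    ultimately show "\<sigma>s \<in> (\<Union>C\<in>?K. ?L C)" by blast
  qed
  then have "transitive_count p m \<le> card (\<Union>C\<in>?K. ?L C)"
    unfolding transitive_count_def using finK finC
    by (intro card_mono finite_UN_I finite_lists_length_eq)
  also have "\<dots> \<le> (\<Sum>C\<in>?K. card (?L C))" using finK by (rule card_UN_le)
  also have "\<dots> \<le> (\<Sum>C\<in>?K. m ^ p)"
    using finC by (intro sum_mono) (auto simp: card_lists_length_eq intro: power_mono)
  also have "\<dots> \<le> card (Pow ?P) * m ^ p"
  proof -
    have "card ?K \<le> card (Pow ?P)" using finP by (intro card_mono) auto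
    then show ?thesis by simp
  qed
  finally show ?thesis .
qed

definition rotation :: "nat \<Rightarrow> nat \<Rightarrow> nat \<Rightarrow> nat" where
  "rotation m a x = (if x < m then (x + a) mod m else x)"

lemma rotation_permutes:
  assumes "m > 0"
  shows "rotation m a permutes {..<m}"
proof (rule bij_imp_permutes)
  have "inj_on (rotation m a) {..<m}"
  proof (rule inj_onI)
    fix x y assume xy: "x \<in> {..<m}" "y \<in> {..<m}" "rotation m a x = rotation m a y"
    then have "(x + a) mod m = (y + a) mod m" by (simp add: rotation_def)
    then have "(x + a + (m - a mod m)) mod m = (y + a + (m - a mod m)) mod m"
      by (metis mod_add_left_eq)
    moreover have "(z + a + (m - a mod m)) mod m = z mod m" for z
    proof -
      have "(z + a + (m - a mod m)) mod m = (z + (a mod m + (m - a mod m))) mod m"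
        by (metis add.assoc mod_add_left_eq mod_add_right_eq)
      then show ?thesis using assms by simp
    qed
    ultimately show "x = y" using xy by simp
  qed
  moreover have "rotation m a ` {..<m} \<subseteq> {..<m}" using assms by (auto simp: rotation_def)
  ultimately show "bij_betw (rotation m a) {..<m} {..<m}"
    by (simp add: bij_betw_def endo_inj_surj)
qed (simp add: rotation_def)

lemma card_reach_eq_1I:
  assumes "finite S" "\<forall>\<sigma>\<in>F. \<sigma> permutes S" "a \<in> S" "S \<subseteq> reach F a"
  shows "card (reach F ` S) = 1"
proof -
  have "reach F x = reach F a" if "x \<in> S" for x
    using reach_eq[OF assms(1-3), of x] that assms(4) by blast
  then have "reach F ` S = (\<lambda>_. reach F a) ` S" by (rule image_cong[OF HOL.refl])
  also have "\<dots> = {reach F a}" using assms(3) by auto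
  finally have "reach F ` S = {reach F a}" .
  then show ?thesis by simp
qed

text \<open>The first entry is the rotation by one, which makes the tuple transitive; the remaining \<open>p\<close>
entries are arbitrary rotations.\<close>

lemma transitive_count_ge:
  assumes "m > 0"
  shows "m ^ p \<le> transitive_count (Suc p) m"
proof -
  let ?L = "{l. set l \<subseteq> {..<m} \<and> length l = p}"
  let ?f = "\<lambda>l. rotation m 1 # map (rotation m) l"
  have "?f l \<in> comm_tuples (Suc p) {..<m} 1" if "l \<in> ?L" for l
  proof -
    let ?F = "set (?f l)"
    have perm: "\<forall>\<sigma>\<in>?F. \<sigma> permutes {..<m}" using rotation_permutes[OF assms] by auto
    have "rotation m a \<circ> rotation m b = rotation m b \<circ> rotation m a" for a b
      using assms by (auto simp: rotation_def fun_eq_iff mod_simps ac_simps)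
    then have comm: "\<forall>\<sigma>\<in>?F. \<forall>\<tau>\<in>?F. \<sigma> \<circ> \<tau> = \<tau> \<circ> \<sigma>" by auto
    have from0: "x \<in> reach ?F 0" if "x < m" for x
      using that
    proof (induction x)
      case 0
      show ?case by (rule reach.refl)
    next
      case (Suc x)
      have "rotation m 1 x \<in> reach ?F 0" using Suc by (intro reach.step[where \<sigma> = "rotation m 1"]) auto
      moreover have "rotation m 1 x = Suc x" using Suc.prems by (simp add: rotation_def)
      ultimately show ?case by simp
    qed
    have "{..<m} \<subseteq> reach ?F 0"
      by (rule subsetI) (rule from0, simp only: lessThan_iff)
    moreover have "0 \<in> {..<m}" using assms by simp
    ultimately have "card (reach ?F ` {..<m}) = 1"
      using card_reach_eq_1I[of "{..<m}" ?F 0] perm finite_lessThan by metis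
    moreover have "length (?f l) = Suc p" using that by simp
    ultimately show ?thesis unfolding comm_tuples_def using perm comm by blast
  qed
  then have "?f ` ?L \<subseteq> comm_tuples (Suc p) {..<m} 1" by blast
  moreover have "inj_on ?f ?L"
  proof (rule inj_onI)
    fix l l' assume l: "l \<in> ?L" "l' \<in> ?L" "?f l = ?f l'"
    have "inj_on (rotation m) {..<m}"
    proof (rule inj_onI)
      fix a b assume ab: "a \<in> {..<m}" "b \<in> {..<m}" "rotation m a = rotation m b"
      have "rotation m i 0 = i" if "i < m" for i using that by (simp add: rotation_def)
      then show "a = b" using ab by (metis lessThan_iff)
    qed
    then have "inj_on (rotation m) (set l \<union> set l')" using l by (auto intro: inj_on_subset)
    then show "l = l'" using l(3) by (simp add: inj_on_map_eq_map)
  qed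
  ultimately have "card ?L \<le> transitive_count (Suc p) m"
    unfolding transitive_count_def
    by (intro card_inj_on_le[where f = ?f] finite_comm_tuples finite_lessThan)
  then show ?thesis by (simp add: card_lists_length_eq)
qed

section \<open>Coefficients of powers of power series\<close>

text \<open>Multiplying the coefficients by a geometric sequence multiplies the coefficients of the \<open>k\<close>-th power
by \<open>a ^ k * s ^ n\<close>. For fixed \<open>n\<close> this is geometric in \<open>k\<close>, so it cancels when the square of
one such coefficient is divided by the product of its two neighbours in \<open>k\<close>.\<close>

lemma fps_power_nth_scale:
  fixes f :: "nat \<Rightarrow> 'a :: comm_ring_1"
  shows "(Abs_fps (\<lambda>m. f m * a * s ^ m) ^ k) $ n = (Abs_fps f ^ k) $ n * a ^ k * s ^ n"
proof (induction k arbitrary: n)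
  case (Suc k)
  have "(Abs_fps (\<lambda>m. f m * a * s ^ m) ^ Suc k) $ n =
      (\<Sum>i=0..n. (f i * a * s ^ i) * ((Abs_fps f ^ k) $ (n - i) * a ^ k * s ^ (n - i)))"
    by (simp add: fps_mult_nth Suc.IH)
  also have "\<dots> = (\<Sum>i=0..n. f i * (Abs_fps f ^ k) $ (n - i) * a ^ Suc k * s ^ n)"
  proof (rule sum.cong[OF HOL.refl])
    fix i assume "i \<in> {0..n}"
    then have "s ^ n = s ^ i * s ^ (n - i)" by (simp flip: power_add)
    then show "(f i * a * s ^ i) * ((Abs_fps f ^ k) $ (n - i) * a ^ k * s ^ (n - i)) =
        f i * (Abs_fps f ^ k) $ (n - i) * a ^ Suc k * s ^ n"
      by (simp add: algebra_simps)
  qed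
  finally show ?case by (simp add: fps_mult_nth sum_distrib_right)
qed simp

lemma fps_power_nth_pos:
  fixes F :: "real fps"
  assumes "\<And>m. F $ m \<ge> 0" "\<And>m. m > 0 \<Longrightarrow> F $ m > 0" "0 < k" "k \<le> n"
  shows "(F ^ k) $ n > 0"
proof -
  have nonneg: "(F ^ j) $ i \<ge> 0" for j i
    by (induction j arbitrary: i) (auto simp: fps_mult_nth assms(1) intro!: sum_nonneg mult_nonneg_nonneg)
  show ?thesis using assms(3,4)
  proof (induction k arbitrary: n rule: nat_induct_non_zero)
    case 1
    then show ?case using assms(2) by simp
  next
    case (Suc k)
    have "0 < F $ 1 * (F ^ k) $ (n - 1)" using Suc assms(2) by (intro mult_pos_pos) auto
    also have "\<dots> \<le> (\<Sum>i=0..n. F $ i * (F ^ k) $ (n - i))"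
      using Suc.prems by (intro member_le_sum) (auto simp: nonneg assms(1))
    finally show ?case by (simp add: fps_mult_nth)
  qed
qed

lemma Bseq_sum:
  fixes f :: "'i \<Rightarrow> nat \<Rightarrow> real"
  assumes "\<And>i. i \<in> I \<Longrightarrow> Bseq (f i)"
  shows "Bseq (\<lambda>p. \<Sum>i\<in>I. f i p)"
proof (cases "finite I")
  case True
  have add: "Bseq (\<lambda>p. g p + h p)" if gh: "Bseq g" "Bseq h" for g h :: "nat \<Rightarrow> real"
  proof -
    obtain K L where "\<And>p. norm (g p) \<le> K" "\<And>p. norm (h p) \<le> L" using gh unfolding Bseq_def by blast
    then show ?thesis by (intro BseqI'[of _ "K + L"] norm_triangle_le add_mono)
  qed
  show ?thesis using True assms by (induction I) (auto intro: add)
qed simp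

lemma tendsto_zero_mult_Bseq:
  fixes f g :: "nat \<Rightarrow> real"
  assumes "f \<longlonglongrightarrow> 0" "Bseq g"
  shows "(\<lambda>p. f p * g p) \<longlonglongrightarrow> 0"
  using assms by (simp add: tendsto_Zfun_iff bounded_bilinear.Zfun_prod_Bfun[OF bounded_bilinear_mult])

text \<open>A coefficient of a power is a polynomial in finitely many coefficients of the base, hence
uniformly continuous on bounded sets.\<close>

lemma fps_power_nth_perturb:
  fixes F G :: "nat \<Rightarrow> real fps"
  assumes F: "\<And>m. Bseq (\<lambda>p. F p $ m)" and G: "\<And>m. Bseq (\<lambda>p. G p $ m)"
    and FG: "\<And>m. (\<lambda>p. F p $ m - G p $ m) \<longlonglongrightarrow> 0"
  shows "Bseq (\<lambda>p. (G p ^ k) $ n)" "(\<lambda>p. (F p ^ k) $ n - (G p ^ k) $ n) \<longlonglongrightarrow> 0"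
proof -
  have B: "Bseq (\<lambda>p. (H p ^ k) $ n)" if "\<And>m. Bseq (\<lambda>p. H p $ m)" for H :: "nat \<Rightarrow> real fps" and k n
  proof (induction k arbitrary: n)
    case (Suc k)
    then show ?case using that by (auto simp: fps_mult_nth intro!: Bseq_sum Bseq_mult)
  qed simp
  show "Bseq (\<lambda>p. (G p ^ k) $ n)" using G by (rule B)
  show "(\<lambda>p. (F p ^ k) $ n - (G p ^ k) $ n) \<longlonglongrightarrow> 0"
  proof (induction k arbitrary: n)
    case (Suc k)
    have "(F p ^ Suc k) $ n - (G p ^ Suc k) $ n = (\<Sum>i=0..n. (F p $ i - G p $ i) * (F p ^ k) $ (n - i)
        + ((F p ^ k) $ (n - i) - (G p ^ k) $ (n - i)) * G p $ i)" for p
      by (simp add: fps_mult_nth algebra_simps flip: sum_subtractf)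
    moreover have "(\<lambda>p. \<Sum>i=0..n. (F p $ i - G p $ i) * (F p ^ k) $ (n - i)
        + ((F p ^ k) $ (n - i) - (G p ^ k) $ (n - i)) * G p $ i) \<longlonglongrightarrow> 0"
      by (intro tendsto_null_sum tendsto_add_zero tendsto_zero_mult_Bseq FG Suc.IH B F G)
    ultimately show ?case by presburger
  qed simp
qed

section \<open>Log-concavity for series with two adjacent exponents\<close>

definition two_term_fps :: "nat \<Rightarrow> real \<Rightarrow> real \<Rightarrow> real fps" where
  "two_term_fps q \<alpha> \<beta> = Abs_fps (\<lambda>m. if m = q then \<alpha> else if m = Suc q then \<beta> else 0)"

text \<open>A composition of \<open>n\<close> into \<open>j\<close> parts from \<open>{q, q + 1}\<close> has exactly \<open>n - q * j\<close> parts \<open>q + 1\<close>.\<close>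

lemma two_term_fps_power_nth:
  "(two_term_fps q \<alpha> \<beta> ^ j) $ n =
    (if n < q * j then 0 else real (j choose (n - q * j)) * \<alpha> ^ (j - (n - q * j)) * \<beta> ^ (n - q * j))"
proof -
  have eq: "two_term_fps q \<alpha> \<beta> = fps_X ^ q * (fps_const \<beta> * fps_X + fps_const \<alpha>)"
  proof -
    have "fps_X ^ q * (fps_const \<beta> * fps_X + fps_const \<alpha>) =
        fps_const \<beta> * fps_X ^ Suc q + fps_const \<alpha> * fps_X ^ q"
      by (simp add: algebra_simps)
    then show ?thesis by (auto simp: fps_eq_iff two_term_fps_def fps_X_power_iff simp del: power_Suc)
  qed
  have lin: "((fps_const \<beta> * fps_X + fps_const \<alpha>) ^ j) $ i = real (j choose i) * \<alpha> ^ (j - i) * \<beta> ^ i" for i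
  proof -
    have "((fps_const \<beta> * fps_X + fps_const \<alpha>) ^ j) $ i =
        (\<Sum>l\<le>j. real (j choose l) * (\<beta> ^ l * ((if i = l then 1 else 0) * \<alpha> ^ (j - l))))"
      by (simp add: binomial_ring fps_sum_nth power_mult_distrib fps_const_power mult.assoc
          fps_X_power_iff flip: fps_of_nat)
    also have "\<dots> = (\<Sum>l\<le>j. if i = l then real (j choose l) * \<alpha> ^ (j - l) * \<beta> ^ l else 0)"
      by (intro sum.cong) auto
    finally have "((fps_const \<beta> * fps_X + fps_const \<alpha>) ^ j) $ i = \<dots>" .
    then show ?thesis by (simp add: binomial_eq_0)
  qed
  show ?thesis
    by (simp add: eq power_mult_distrib fps_X_power_mult_nth lin flip: power_mult)
qed

text \<open>This compares the binomial coefficients of \<open>2 * (c + d)\<close> over \<open>c\<close> and over the middle.\<close>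

lemma fact_log_convex: "(fact (c + d))\<^sup>2 \<le> (fact c * fact (c + 2 * d) :: real)"
proof -
  have "real ((2 * (c + d)) choose c) \<le> real ((2 * (c + d)) choose (c + d))"
    using binomial_maximum' of_nat_mono by blast
  moreover have "2 * (c + d) - c = c + 2 * d" "2 * (c + d) - (c + d) = c + d" by simp_all
  ultimately have "fact (2 * (c + d)) / (fact c * fact (c + 2 * d)) \<le>
      (fact (2 * (c + d)) / (fact (c + d) * fact (c + d)) :: real)"
    by (simp add: binomial_fact add.commute)
  then show ?thesis by (simp add: field_simps power2_eq_square)
qed

text \<open>Where it does not vanish, \<open>W j = \<alpha> ^ a * \<beta> ^ b / (fact a * fact b)\<close> with \<open>a\<close> and \<open>b\<close> affine in
\<open>j\<close>. The powers of \<open>\<alpha>\<close> and \<open>\<beta>\<close> then agree on both sides of the inequality, and what remains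
is the log-convexity of the factorial.\<close>

lemma two_term_log_concave:
  fixes \<alpha> \<beta> :: real and q n :: nat
  assumes "\<alpha> \<ge> 0" "\<beta> \<ge> 0"
  defines "W \<equiv> \<lambda>j. (two_term_fps q \<alpha> \<beta> ^ j) $ n / fact j"
  shows "W j * W (j + 2) \<le> (W (j + 1))\<^sup>2"
proof (cases "q * (j + 2) \<le> n \<and> n - q * j \<le> j")
  case False
  then have "W j = 0 \<or> W (j + 2) = 0"
    unfolding W_def two_term_fps_power_nth by (auto simp: not_le binomial_eq_0)
  then show ?thesis by (metis mult_zero_left mult_zero_right zero_le_power2)
next
  case True
  obtain c where n: "n = q * (j + 2) + c" using True le_Suc_ex by blast
  then have sub: "n - q * j = c + 2 * q" "n - q * (j + 1) = c + q" "n - q * (j + 2) = c"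
    by (simp_all add: algebra_simps)
  then obtain d where j: "j = c + 2 * q + d" using True le_Suc_ex by metis
  have ge: "\<not> n < q * j" "\<not> n < q * (j + 1)" "\<not> n < q * (j + 2)"
    unfolding n by simp_all
  \<comment> \<open>Here \<open>b\<close> counts the parts \<open>q + 1\<close> and \<open>a\<close> the parts \<open>q\<close>.\<close>
  have W: "W i = \<alpha> ^ a * \<beta> ^ b / (fact a * fact b)"
    if "i = a + b" "n - q * i = b" "\<not> n < q * i" for i a b
    unfolding W_def two_term_fps_power_nth using that by (simp add: binomial_fact)
  have "W j * W (j + 2) = (\<alpha> ^ d * \<beta> ^ (c + 2 * q) / (fact d * fact (c + 2 * q))) *
      (\<alpha> ^ (d + 2 * (q + 1)) * \<beta> ^ c / (fact (d + 2 * (q + 1)) * fact c))"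
    using W[OF _ sub(1) ge(1), of d] W[OF _ sub(3) ge(3), of "d + 2 * (q + 1)"] j by simp
  also have "\<dots> = (\<alpha> ^ (d + (q + 1)) * \<beta> ^ (c + q))\<^sup>2 /
      ((fact d * fact (d + 2 * (q + 1))) * (fact c * fact (c + 2 * q)))"
  proof -
    have sq: "x ^ u * x ^ (u + 2 * v) = (x ^ (u + v))\<^sup>2" for x :: real and u v
      by (simp add: power2_eq_square mult_2 add_ac flip: power_add)
    have "(\<alpha> ^ d * \<beta> ^ (c + 2 * q) / (fact d * fact (c + 2 * q))) *
        (\<alpha> ^ (d + 2 * (q + 1)) * \<beta> ^ c / (fact (d + 2 * (q + 1)) * fact c)) =
        (\<alpha> ^ d * \<alpha> ^ (d + 2 * (q + 1))) * (\<beta> ^ c * \<beta> ^ (c + 2 * q)) /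
        ((fact d * fact (d + 2 * (q + 1))) * (fact c * fact (c + 2 * q)))"
      by (simp only: times_divide_times_eq mult_ac)
    then show ?thesis unfolding sq by (simp only: power_mult_distrib)
  qed
  also have "\<dots> \<le> (\<alpha> ^ (d + (q + 1)) * \<beta> ^ (c + q))\<^sup>2 / ((fact (d + (q + 1)))\<^sup>2 * (fact (c + q))\<^sup>2)"
    by (intro divide_left_mono mult_mono fact_log_convex) auto
  also have "\<dots> = (W (j + 1))\<^sup>2"
    using W[OF _ sub(2) ge(2), of "d + (q + 1)"] j by (simp add: power_divide power_mult_distrib)
  finally show ?thesis .
qed

section \<open>Normalisation and the limit\<close>

text \<open>The exponential \<open>m \<mapsto> q * r ^ (m - q)\<close> through the points \<open>(q, q)\<close> and \<open>(q + 1, q + 1)\<close> lies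
strictly above the identity at all other integers: \<open>ln\<close> is strictly concave, so it lies below its
chord outside the interval. The proof multiplies or divides by \<open>r\<close> repeatedly, moving away from the
interval on either side.\<close>

lemma supporting_exponential:
  fixes q m :: nat
  assumes "q > 0"
  defines "r \<equiv> 1 + 1 / real q"
  shows "m = q \<or> m = Suc q \<Longrightarrow> real q / r ^ q * r ^ m = real m"
    and "m \<noteq> q \<Longrightarrow> m \<noteq> Suc q \<Longrightarrow> real m < real q / r ^ q * r ^ m"
proof -
  have r: "r > 0" "r > 1" "real q * r = real q + 1"
    using assms(1) by (auto simp: r_def field_simps add_pos_pos)
  show "real q / r ^ q * r ^ m = real m" if "m = q \<or> m = Suc q" using that r by auto
  show "real m < real q / r ^ q * r ^ m" if "m \<noteq> q" "m \<noteq> Suc q"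
  proof (cases "m < q")
    case True
    have "real (q - i) < real q / r ^ i" if "0 < i" "i \<le> q" for i
      using that
    proof (induction i rule: nat_induct_non_zero)
      case 1
      show ?case using r assms(1) by (simp add: field_simps of_nat_diff)
    next
      case (Suc i)
      have "real (q - Suc i) * r = real (q - i) - real (Suc i) / real q" if "Suc i \<le> q"
        using that assms(1) by (simp add: r_def field_simps of_nat_diff)
      then have "real (q - Suc i) * r \<le> real (q - i)" using Suc.prems by simp
      also have "\<dots> < real q / r ^ i" using Suc by simp
      finally show ?case using r by (simp add: field_simps)
    qed
    from this[of "q - m"] have "real m < real q / r ^ (q - m)" using True by simp
    also have "\<dots> = real q / r ^ q * r ^ m"
      using True r by (simp add: power_diff)
    finally show ?thesis .
  next
    case False
    have "real (Suc q + i) < real q * r ^ (Suc i)" if "0 < i" for i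
      using that
    proof (induction i rule: nat_induct_non_zero)
      case 1
      have "real q * r ^ Suc 1 = (real q + 1) * r" using r(3) by (simp add: mult.assoc[symmetric])
      also have "\<dots> = real q + 2 + 1 / real q" using assms(1) by (simp add: r_def field_simps)
      finally show ?case using assms(1) by simp
    next
      case (Suc i)
      have "real (Suc q + Suc i) \<le> real (Suc q + i) * r"
        using assms(1) by (simp add: r_def field_simps)
      also have "\<dots> < real q * r ^ Suc i * r" using Suc r by (intro mult_strict_right_mono) auto
      finally show ?case by (simp add: mult_ac)
    qed
    from this[of "m - Suc q"] have "real m < real q * r ^ (m - q)"
      using False that by (simp add: Suc_diff_Suc)
    also have "\<dots> = real q / r ^ q * r ^ m"
      using False r by (simp add: power_diff)
    finally show ?thesis .
  qed
qed

text \<open>An inequality \<open>x' z' \<le> y'\<^sup>2\<close> between bounded sequences, with \<open>y'\<close> bounded away from \<open>0\<close>, survives a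
vanishing perturbation up to a factor tending to \<open>1\<close>.\<close>

lemma liminf_ratio_ge_one:
  fixes x y z x' y' z' :: "nat \<Rightarrow> real"
  assumes lim: "(\<lambda>p. x p - x' p) \<longlonglongrightarrow> 0" "(\<lambda>p. y p - y' p) \<longlonglongrightarrow> 0" "(\<lambda>p. z p - z' p) \<longlonglongrightarrow> 0"
    and B: "Bseq x'" "Bseq y'" "Bseq z'"
    and le: "\<And>p. x' p * z' p \<le> (y' p)\<^sup>2"
    and \<delta>: "\<delta> > 0" "\<forall>\<^sub>F p in sequentially. \<delta> \<le> y' p"
    and pos: "\<forall>\<^sub>F p in sequentially. 0 < x p \<and> 0 < z p"
  shows "1 \<le> liminf (\<lambda>p. ennreal ((y p)\<^sup>2 / (x p * z p)))"
proof -
  \<comment> \<open>Since \<open>x' z' \<le> y'\<^sup>2\<close>, the product \<open>x z\<close> exceeds \<open>y\<^sup>2\<close> by at most this null sequence.\<close>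
  let ?e = "\<lambda>p. \<bar>((y p)\<^sup>2 - (y' p)\<^sup>2) - (x p * z p - x' p * z' p)\<bar>"
  have "(\<lambda>p. (y p - y' p) * (y p - y' p) + 2 * ((y p - y' p) * y' p) -
      ((x p - x' p) * (z p - z' p) + (x p - x' p) * z' p + (z p - z' p) * x' p)) \<longlonglongrightarrow> 0 * 0 + 2 * 0 - (0 * 0 + 0 + 0)"
    by (intro tendsto_intros tendsto_zero_mult_Bseq lim B)
  then have "?e \<longlonglongrightarrow> 0"
    by (intro tendsto_rabs_zero) (simp add: algebra_simps power2_eq_square)
  then have "(\<lambda>p. 1 / (1 + ?e p / (\<delta> / 2)\<^sup>2)) \<longlonglongrightarrow> 1 / (1 + 0 / (\<delta> / 2)\<^sup>2)"
    using \<delta>(1) by (intro tendsto_intros) auto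
  then have "(\<lambda>p. ennreal (1 / (1 + ?e p / (\<delta> / 2)\<^sup>2))) \<longlonglongrightarrow> 1"
    using tendsto_ennrealI by fastforce
  then have "liminf (\<lambda>p. ennreal (1 / (1 + ?e p / (\<delta> / 2)\<^sup>2))) = 1"
    by (intro lim_imp_Liminf) auto
  moreover have "\<forall>\<^sub>F p in sequentially. \<bar>y p - y' p\<bar> < \<delta> / 2"
    using order_tendstoD(2)[OF tendsto_rabs_zero[OF lim(2)], of "\<delta> / 2"] \<delta>(1) by simp
  then have "\<forall>\<^sub>F p in sequentially. ennreal (1 / (1 + ?e p / (\<delta> / 2)\<^sup>2)) \<le> ennreal ((y p)\<^sup>2 / (x p * z p))"
    using \<delta>(2) pos
  proof eventually_elim
    case (elim p)
    have y: "\<delta> / 2 \<le> y p" using elim by linarith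
    then have y2: "(\<delta> / 2)\<^sup>2 \<le> (y p)\<^sup>2" using \<delta>(1) by (intro power_mono) auto
    have xz: "0 < x p * z p" using elim by simp
    have y0: "0 < (y p)\<^sup>2" using y \<delta>(1) by simp
    have "1 / (1 + ?e p / (\<delta> / 2)\<^sup>2) \<le> 1 / (1 + ?e p / (y p)\<^sup>2)"
      using y2 y0 \<delta>(1) by (intro divide_left_mono add_mono mult_pos_pos add_pos_nonneg) auto
    also have "\<dots> = (y p)\<^sup>2 / ((y p)\<^sup>2 + ?e p)" using y0 by (simp add: field_simps)
    also have "\<dots> \<le> (y p)\<^sup>2 / (x p * z p)"
    proof (rule divide_left_mono)
      show "x p * z p \<le> (y p)\<^sup>2 + ?e p" using le[of p] by linarith
      have "0 < (y p)\<^sup>2 + ?e p" by (intro add_pos_nonneg y0) simp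
      then show "0 < ((y p)\<^sup>2 + ?e p) * (x p * z p)" using xz by (rule mult_pos_pos)
    qed simp
    finally show ?case by (rule ennreal_leI)
  qed
  then have "liminf (\<lambda>p. ennreal (1 / (1 + ?e p / (\<delta> / 2)\<^sup>2))) \<le> liminf (\<lambda>p. ennreal ((y p)\<^sup>2 / (x p * z p)))"
    by (rule Liminf_mono)
  ultimately show ?thesis by (rule ord_eq_le_trans[OF sym])
qed

text \<open>Dividing the upper bound for the number of transitive tuples, a constant times \<open>m ^ p\<close>, by \<open>h ^ p\<close>
leaves a constant times \<open>(m / h) ^ p\<close>.\<close>

lemma normalised_count_bounded:
  assumes m: "m > 0" and h: "real m \<le> h"
  shows "Bseq (\<lambda>p. transitive_egf p $ m / h ^ p)"
    and "real m < h \<Longrightarrow> (\<lambda>p. transitive_egf p $ m / h ^ p) \<longlonglongrightarrow> 0"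
proof -
  define D where "D = real (card (Pow {\<sigma>. \<sigma> permutes {..<m}})) / fact m"
  have h0: "h > 0" using m h by simp
  have le: "norm (transitive_egf p $ m / h ^ p) \<le> D * (real m / h) ^ p" for p
  proof -
    have "real (transitive_count p m) \<le> real (card (Pow {\<sigma>. \<sigma> permutes {..<m}})) * real m ^ p"
      using of_nat_mono[OF transitive_count_le[of p m], where 'a = real] by (simp del: card_Pow)
    then have "transitive_egf p $ m \<le> D * real m ^ p"
      by (simp add: transitive_egf_def D_def divide_right_mono del: card_Pow)
    then have "transitive_egf p $ m / h ^ p \<le> D * real m ^ p / h ^ p"
      using h0 by (intro divide_right_mono) auto
    moreover have "transitive_egf p $ m \<ge> 0" by (simp add: transitive_egf_def)
    ultimately show ?thesis using h0 by (simp add: power_divide)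
  qed
  have D: "D \<ge> 0" by (simp add: D_def)
  show "Bseq (\<lambda>p. transitive_egf p $ m / h ^ p)"
  proof (rule BseqI'[of _ D])
    fix p
    have "(real m / h) ^ p \<le> 1" using h h0 by (intro power_le_one) auto
    then have "D * (real m / h) ^ p \<le> D * 1" using D by (intro mult_left_mono)
    then show "norm (transitive_egf p $ m / h ^ p) \<le> D" using le[of p] by linarith
  qed
  assume "real m < h"
  then have "(\<lambda>p. (real m / h) ^ p) \<longlonglongrightarrow> 0" using h0 by (intro LIMSEQ_realpow_zero) auto
  then have "(\<lambda>p. D * (real m / h) ^ p) \<longlonglongrightarrow> 0" by (rule tendsto_mult_right_zero)
  then show "(\<lambda>p. transitive_egf p $ m / h ^ p) \<longlonglongrightarrow> 0"
  proof (rule tendsto_0_le)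
    have "D * (real m / h) ^ p \<le> norm (D * (real m / h) ^ p) * 1" for p by simp
    then show "\<forall>\<^sub>F p in sequentially. norm (transitive_egf p $ m / h ^ p) \<le> norm (D * (real m / h) ^ p) * 1"
      using le order_trans by (intro always_eventually) blast
  qed
qed

lemma normalised_count_ge:
  assumes "m > 0" "p > 0"
  shows "1 / (fact m * real m) \<le> transitive_egf p $ m / real m ^ p"
proof -
  obtain p' where p: "p = Suc p'" using assms(2) gr0_implies_Suc by blast
  have "real m ^ p' \<le> real (transitive_count p m)"
    using of_nat_mono[OF transitive_count_ge[OF assms(1), of p'], where 'a = real] p by simp
  then show ?thesis using assms(1) by (simp add: transitive_egf_def p field_simps)
qed

theorem theorem1p1:
  fixes n k :: nat
  assumes "n \<ge> 3" and "2 \<le> k" and "k \<le> n - 1"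
  shows "liminf (\<lambda>p. ennreal (real (A p n k) ^ 2 / (real (A p n (k - 1)) * real (A p n (k + 1))))) \<ge> 1"
proof -
  \<comment> \<open>A balanced composition of \<open>n\<close> into \<open>k\<close> parts uses only the parts \<open>q\<close> and \<open>q + 1\<close>.\<close>
  define q where "q = n div k"
  have k: "0 < k" "k \<le> n" using assms by auto
  have q: "q > 0" using k by (simp add: q_def div_greater_zero_iff)
  define r where "r = 1 + 1 / real q"
  define c where "c = real q / r ^ q"
  have r0: "r > 0" and c0: "c > 0" using q by (auto simp: r_def c_def add_pos_pos)
  note tangent = supporting_exponential[OF q, folded r_def, folded c_def]
  have h: "real m \<le> c * r ^ m" for m
    using tangent[of m] by (cases "m = q \<or> m = Suc q") auto
  \<comment> \<open>The normalised weight of an orbit of size \<open>m\<close>: it tends to \<open>0\<close> as \<open>p\<close> grows unless \<open>m\<close> is \<open>q\<close> or \<open>q + 1\<close>.\<close>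
  define u where "u p m = transitive_egf p $ m / (c * r ^ m) ^ p" for p m
  define U where "U p = Abs_fps (u p)" for p
  \<comment> \<open>The part of \<open>U p\<close> that does not vanish in the limit.\<close>
  define V where "V p = two_term_fps q (u p q) (u p (Suc q))" for p
  define a where "a j p = (U p ^ j) $ n / fact j" for j p
  define w where "w j p = (V p ^ j) $ n / fact j" for j p

  have egf_0: "transitive_egf p $ 0 = 0" for p
    by (simp add: transitive_egf_def transitive_count_def comm_tuples_def)
  have u_nonneg: "u p m \<ge> 0" for p m
    using c0 r0 by (simp add: u_def transitive_egf_def)
  have u_ge: "1 / (fact m * real m) \<le> u p m" if "m = q \<or> m = Suc q" "p > 0" for p m
    using normalised_count_ge[of m p] that q tangent(1)[of m] by (auto simp: u_def)
  have u_pos: "u p m > 0" if "m > 0" "p > 0" for p m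
  proof -
    have "0 < transitive_egf p $ m / real m ^ p"
      using normalised_count_ge[OF that] that by (intro less_le_trans[OF _ normalised_count_ge[OF that]]) auto
    then show ?thesis using c0 r0 that by (simp add: u_def zero_less_divide_iff)
  qed
  have U_bounded: "Bseq (\<lambda>p. U p $ m)" for m
  proof (cases "m = 0")
    case True
    then show ?thesis by (simp add: U_def u_def egf_0)
  next
    case False
    then show ?thesis using normalised_count_bounded(1)[OF _ h, of m] by (simp add: U_def u_def)
  qed
  have V_bounded: "Bseq (\<lambda>p. V p $ m)" for m
    using U_bounded[of m] by (cases "m = q"; cases "m = Suc q") (simp_all add: U_def V_def two_term_fps_def)
  have UV: "(\<lambda>p. U p $ m - V p $ m) \<longlonglongrightarrow> 0" for m
  proof (cases "m = 0 \<or> m = q \<or> m = Suc q")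
    case True
    then show ?thesis using q by (auto simp: U_def V_def two_term_fps_def u_def egf_0)
  next
    case False
    then show ?thesis using normalised_count_bounded(2)[OF _ h, of m] tangent(2)[of m]
      by (simp add: U_def V_def two_term_fps_def u_def)
  qed
  have aw: "(\<lambda>p. a j p - w j p) \<longlonglongrightarrow> 0" and w_bounded: "Bseq (w j)" for j
  proof -
    note perturb = fps_power_nth_perturb[where F = U and G = V, OF U_bounded V_bounded UV, of j n]
    have "(\<lambda>p. ((U p ^ j) $ n - (V p ^ j) $ n) / fact j) \<longlonglongrightarrow> 0 / fact j"
      by (intro tendsto_intros perturb(2)) simp
    then show "(\<lambda>p. a j p - w j p) \<longlonglongrightarrow> 0" by (simp add: a_def w_def diff_divide_distrib)
    have "Bseq (\<lambda>p. (V p ^ j) $ n * (1 / fact j))" by (intro Bseq_mult perturb(1)) simp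
    moreover have "w j = (\<lambda>p. (V p ^ j) $ n * (1 / fact j))" by (simp add: w_def fun_eq_iff)
    ultimately show "Bseq (w j)" by simp
  qed
  have w_concave: "w (k - 1) p * w (k + 1) p \<le> (w k p)\<^sup>2" for p
  proof -
    have "k - 1 + 1 = k" "k - 1 + 2 = k + 1" using k by simp_all
    then show ?thesis
      using two_term_log_concave[OF u_nonneg u_nonneg, where q = q and n = n and j = "k - 1"]
      unfolding w_def V_def by metis
  qed

  \<comment> \<open>The coefficient \<open>w k p\<close> is a single nonzero term, with \<open>n mod k\<close> parts \<open>q + 1\<close>; here both weights are replaced by their lower bounds.\<close>
  define \<delta> where "\<delta> = real (k choose (n mod k)) * (1 / (fact q * real q)) ^ (k - n mod k) *
    (1 / (fact (Suc q) * real (Suc q))) ^ (n mod k) / fact k"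
  have "n mod k < k" using k by simp
  then have \<delta>: "\<delta> > 0" using q by (simp add: \<delta>_def)
  have w_ge: "\<delta> \<le> w k p" if "p > 0" for p
  proof -
    have n: "n - q * k = n mod k" "\<not> n < q * k"
      by (auto simp: q_def minus_div_mult_eq_mod not_less)
    show ?thesis
      unfolding w_def V_def two_term_fps_power_nth n \<delta>_def if_not_P[OF n(2)]
      using u_ge[of q p] u_ge[of "Suc q" p] that u_nonneg
      by (intro divide_right_mono mult_mono power_mono) auto
  qed
  have a_pos: "a j p > 0" if "0 < j" "j \<le> n" "p > 0" for j p
    using fps_power_nth_pos[of "U p" j n] that u_nonneg u_pos by (simp add: a_def U_def)

  have liminf: "1 \<le> liminf (\<lambda>p. ennreal ((a k p)\<^sup>2 / (a (k - 1) p * a (k + 1) p)))"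
  proof (rule liminf_ratio_ge_one[where \<delta> = \<delta>])
    show "\<forall>\<^sub>F p in sequentially. \<delta> \<le> w k p"
      using eventually_gt_at_top[of 0] by eventually_elim (rule w_ge)
    show "\<forall>\<^sub>F p in sequentially. 0 < a (k - 1) p \<and> 0 < a (k + 1) p"
      using eventually_gt_at_top[of 0] by eventually_elim (use assms in \<open>auto intro!: a_pos\<close>)
  qed (use aw w_bounded w_concave \<delta> in auto)

  have A: "real (A p n j) = fact n * (c ^ p) ^ j * (r ^ p) ^ n * a j p" for p j
  proof -
    have "U p = Abs_fps (\<lambda>m. transitive_egf p $ m * (1 / c ^ p) * (1 / r ^ p) ^ m)"
      by (rule fps_ext) (simp add: U_def u_def power_mult_distrib power_divide mult.commute[of p] flip: power_mult)
    then have "(U p ^ j) $ n = (transitive_egf p ^ j) $ n * (1 / c ^ p) ^ j * (1 / r ^ p) ^ n"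
      by (simp only: fps_power_nth_scale fps_nth_inverse)
    then show ?thesis using c0 r0 by (simp add: A_eq_coeff a_def power_divide)
  qed
  have "real (A p n k) ^ 2 / (real (A p n (k - 1)) * real (A p n (k + 1))) =
      (a k p)\<^sup>2 / (a (k - 1) p * a (k + 1) p)" for p
  proof -
    define K where "K = c ^ p"
    define L where "L = fact n * (r ^ p) ^ n"
    have KL: "K \<noteq> 0" "L \<noteq> 0" using c0 r0 by (auto simp: K_def L_def)
    have AKL: "real (A p n j) = L * K ^ j * a j p" for j by (simp add: A K_def L_def)
    \<comment> \<open>The normalisation is geometric in the number of orbits, so it leaves the ratio unchanged.\<close>
    have "(L * K ^ k)\<^sup>2 = (L * K ^ (k - 1)) * (L * K ^ (k + 1))"
      using k by (simp add: power2_eq_square flip: power_add) (simp add: ac_simps flip: power_add power_Suc)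
    then show ?thesis unfolding AKL using KL by (simp add: power_mult_distrib)
  qed
  then show ?thesis using liminf by simp
qed

end
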